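(* Let $A\in\mathbb{R}_+^{n\times n}$ be a definite and irreducible matrix with $N_c(A)=\{1,\dots,c\}$, let $\gamma$ be the cyclicity of $\mathcal{C}(A)$, and let $t\ge 0$ be such that $t\gamma\ge T(A)$. Then for every integer $l\ge 0$ and every $1\le k\le n$, $$A^{t\gamma+l}_{k\cdot}=\bigoplus_{i=1}^c a^{(t\gamma)}_{ki}A^{t\gamma+l}_{i\cdot},\qquad A^{t\gamma+l}_{\cdot k}=\bigoplus_{i=1}^c a^{(t\gamma)}_{ik}A^{t\gamma+l}_{\cdot i}.$$
   Context: Max algebra: on $\mathbb{R}_+=[0,\infty)$ put $a\oplus b=\max(a,b)$, $a\otimes b=ab$, extended to matrices by $(A\oplus B)_{ij}=\max(a_{ij},b_{ij})$, $(A\otimes B)_{ij}=\max_k a_{ik}b_{kj}$; $A^k$ is the $k$-th max-algebraic power ($A^0=I$), with entries $a^{(k)}_{ij}$, rows $A^k_{i\cdot}$ and columns $A^k_{\cdot i}$. The digraph $\mathcal{D}(A)$ has nodes $1,\dots,n$ and an edge $(i,j)$ of weight $a_{ij}$ iff $a_{ij}\neq 0$; the weight of a path is the product of its edge weights, and the geometric mean of a cycle with $k$ edges is its weight to the power $1/k$. $\lambda(A)$ is the maximum cycle geometric mean. $A$ is definite if $\lambda(A)=1$, and irreducible if for all nodes $i,j$ there is a path in $\mathcal{D}(A)$ from $i$ to $j$. A cycle is critical if its geometric mean equals $\lambda(A)$; the critical graph $\mathcal{C}(A)$ consists of all nodes (the set $N_c(A)$) and edges belonging to critical cycles. It is assumed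 throughout that the nodes are numbered so that $N_c(A)=\{1,\dots,c\}$. The cyclicity of a strongly connected digraph is the gcd of the lengths of its cycles; the cyclicity $\gamma$ of $\mathcal{C}(A)$ is the lcm of the cyclicities of its strongly connected components. For a definite $B$, $B^*=I\oplus B\oplus\dots\oplus B^{n-1}$ and $Q(B)$ has entries $q_{ij}=\bigoplus_{k\in N_c(B)}b^*_{ik}b^*_{kj}$. The transient $T(A)$ of an irreducible definite $A$ is an integer such that $A^{t\gamma}=Q(A^\gamma)$ whenever $t\gamma\ge T(A)$, and $A^{r+\gamma}=A^r$ for all $r\ge T(A)$ (such an integer exists). *)

theory Defs
  imports
    "Graph_Theory.Digraph_Component"
    "Jordan_Normal_Form.Matrix"
begin

text \<open>
  The semiring \<open>\<real>\<^sub>+\<close> with \<open>\<oplus> = max\<close> and \<open>\<otimes> = \<cdot>\<close> is represented by the nonnegative elements of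
  \<^typ>\<open>real\<close>; nonnegativity of the matrix entries is a hypothesis, not part of the type.
  Matrices and vectors are indexed from 0, so the nodes \<open>1, \<dots>, n\<close> become \<open>0, \<dots>, n - 1\<close>.
\<close>

definition nonneg_mat :: "real mat \<Rightarrow> bool" where
  "nonneg_mat A \<longleftrightarrow> (\<forall>i<dim_row A. \<forall>j<dim_col A. 0 \<le> A $$ (i, j))"

text \<open>Inserting 0, the neutral element of \<open>\<oplus>\<close>, only matters for the empty sum.\<close>

definition max_sum :: "('i \<Rightarrow> real) \<Rightarrow> 'i set \<Rightarrow> real" where
  "max_sum f I = Max (insert 0 (f ` I))"

definition max_sum_vec :: "nat \<Rightarrow> ('i \<Rightarrow> real vec) \<Rightarrow> 'i set \<Rightarrow> real vec" where
  "max_sum_vec n v I = vec n (\<lambda>j. max_sum (\<lambda>i. v i $ j) I)"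

definition max_mult :: "real mat \<Rightarrow> real mat \<Rightarrow> real mat"  (infixl "\<otimes>\<^sub>m" 70) where
  "A \<otimes>\<^sub>m B = mat (dim_row A) (dim_col B)
     (\<lambda>(i, j). max_sum (\<lambda>k. A $$ (i, k) * B $$ (k, j)) {..<dim_col A})"

text \<open>The max-algebraic identity matrix has entries 0 and 1, hence is the usual one.\<close>

primrec max_pow :: "real mat \<Rightarrow> nat \<Rightarrow> real mat" where
  "max_pow A 0 = 1\<^sub>m (dim_row A)"
| "max_pow A (Suc k) = max_pow A k \<otimes>\<^sub>m A"

definition mat_digraph :: "real mat \<Rightarrow> (nat, nat \<times> nat) pre_digraph" where
  "mat_digraph A = \<lparr>verts = {..<dim_row A},
     arcs = {(i, j). i < dim_row A \<and> j < dim_col A \<and> A $$ (i, j) \<noteq> 0},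
     tail = fst, head = snd\<rparr>"

text \<open>A walk is the list of its arcs, as in \<^const>\<open>pre_digraph.awalk\<close>.\<close>

definition walk_weight :: "real mat \<Rightarrow> (nat \<times> nat) list \<Rightarrow> real" where
  "walk_weight A p = prod_list (map (\<lambda>e. A $$ e) p)"

definition geom_mean :: "real mat \<Rightarrow> (nat \<times> nat) list \<Rightarrow> real" where
  "geom_mean A p = root (length p) (walk_weight A p)"

text \<open>
  Cycles are those of \<^const>\<open>pre_digraph.cycle\<close>: they have at least one arc (loops are allowed) and
  do not repeat nodes. A finite digraph has finitely many of them, so the maximum below exists.
  Every closed walk splits into such cycles; therefore admitting all closed walks
  as cycles would change neither the maximum geometric mean, nor the critical graph, nor
  the gcd of the cycle lengths. If there is no cycle, \<open>max_cycle_mean\<close> is 0.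
\<close>

definition max_cycle_mean :: "real mat \<Rightarrow> real" where
  "max_cycle_mean A = Max (insert 0 {geom_mean A p | p. pre_digraph.cycle (mat_digraph A) p})"

definition definite :: "real mat \<Rightarrow> bool" where
  "definite A \<longleftrightarrow> max_cycle_mean A = 1"

definition irreducible_mat :: "real mat \<Rightarrow> bool" where
  "irreducible_mat A \<longleftrightarrow> strongly_connected (mat_digraph A)"

definition critical_cycle :: "real mat \<Rightarrow> (nat \<times> nat) list \<Rightarrow> bool" where
  "critical_cycle A p \<longleftrightarrow>
     pre_digraph.cycle (mat_digraph A) p \<and> geom_mean A p = max_cycle_mean A"

definition critical_nodes :: "real mat \<Rightarrow> nat set" where
  "critical_nodes A = (\<Union>p\<in>{p. critical_cycle A p}. fst ` set p)"

definition critical_graph :: "real mat \<Rightarrow> (nat, nat \<times> nat) pre_digraph" where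
  "critical_graph A = \<lparr>verts = critical_nodes A,
     arcs = (\<Union>p\<in>{p. critical_cycle A p}. set p), tail = fst, head = snd\<rparr>"

definition component_cyclicity :: "('a, 'b) pre_digraph \<Rightarrow> nat" where
  "component_cyclicity G = Gcd {length p | p. pre_digraph.cycle G p}"

definition cyclicity :: "('a, 'b) pre_digraph \<Rightarrow> nat" where
  "cyclicity G = Lcm (component_cyclicity ` pre_digraph.sccs G)"

definition max_star :: "real mat \<Rightarrow> real mat" where
  "max_star B = mat (dim_row B) (dim_row B)
     (\<lambda>(i, j). max_sum (\<lambda>k. max_pow B k $$ (i, j)) {..<dim_row B})"

definition Q_mat :: "real mat \<Rightarrow> real mat" where
  "Q_mat B = mat (dim_row B) (dim_row B)
     (\<lambda>(i, j). max_sum (\<lambda>k. max_star B $$ (i, k) * max_star B $$ (k, j)) (critical_nodes B))"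

text \<open>
  The transient is only specified up to these two properties, not as the least such number,
  so it is a predicate: results are stated for an arbitrary \<open>T\<close> satisfying it.
\<close>

definition is_transient :: "real mat \<Rightarrow> nat \<Rightarrow> bool" where
  "is_transient A T \<longleftrightarrow>
     (let \<gamma> = cyclicity (critical_graph A) in
       (\<forall>t. T \<le> t * \<gamma> \<longrightarrow> max_pow A (t * \<gamma>) = Q_mat (max_pow A \<gamma>)) \<and>
       (\<forall>r\<ge>T. max_pow A (r + \<gamma>) = max_pow A r))"

end

theory Submission
  imports Defs
begin

text \<open>
  If \<open>r\<close> and \<open>s\<close> are at least the transient, then every entry of \<open>A\<^bsup>r+s\<^esup>\<close> is
  \<open>\<Oplus>\<^sub>h a\<^bsup>(r)\<^esup>\<^sub>i\<^sub>h a\<^bsup>(s)\<^esup>\<^sub>h\<^sub>j\<close> with \<open>h\<close> critical. By periodicity the entry is the weight of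
  arbitrarily long walks from \<open>i\<close> to \<open>j\<close>. A long walk avoiding the critical nodes contains many
  noncritical cycles, each of weight at most some \<open>\<rho> < 1\<close>, so its weight tends to 0; hence a long
  optimal walk meets a critical node. There insert many laps of a critical cycle, which cost
  nothing, and cut the resulting walk inside these laps, at a point where the length of the first
  part is congruent to \<open>r\<close> modulo \<open>\<gamma>\<close>. The two parts bound \<open>a\<^bsup>(r)\<^esup>\<^sub>i\<^sub>h\<close> and \<open>a\<^bsup>(s)\<^esup>\<^sub>h\<^sub>j\<close> from below, again
  by periodicity. The proposition is the case where one of \<open>r, s\<close> is \<open>t\<gamma>\<close> and the other \<open>t\<gamma> + l\<close>.
\<close>

section \<open>Max-algebraic sums and weights of walks\<close>

lemma max_sum_nonneg: "finite I \<Longrightarrow> 0 \<le> max_sum f I"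
  by (simp add: max_sum_def)

lemma max_sum_upper: "finite I \<Longrightarrow> i \<in> I \<Longrightarrow> f i \<le> max_sum f I"
  by (simp add: max_sum_def)

lemma max_sum_le_iff: "finite I \<Longrightarrow> max_sum f I \<le> x \<longleftrightarrow> 0 \<le> x \<and> (\<forall>i\<in>I. f i \<le> x)"
  by (simp add: max_sum_def)

lemma max_sum_pos_attained:
  assumes "finite I" "0 < max_sum f I"
  obtains i where "i \<in> I" "f i = max_sum f I"
proof -
  have "max_sum f I \<in> insert 0 (f ` I)"
    unfolding max_sum_def using assms(1) by (intro Max_in) auto
  with assms(2) that show ?thesis by auto
qed

lemma walk_weight_simps [simp]:
  "walk_weight A [] = 1"
  "walk_weight A (e # p) = A $$ e * walk_weight A p"
  "walk_weight A (p @ q) = walk_weight A p * walk_weight A q"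
  by (simp_all add: walk_weight_def)

lemma walk_weight_laps: "walk_weight A (concat (replicate m p)) = walk_weight A p ^ m"
  by (induction m) simp_all

lemma length_laps: "length (concat (replicate m p)) = m * length p"
  by (induction m) simp_all

section \<open>Cycles inside walks of a digraph\<close>

context wf_digraph
begin

lemma awalk_laps: "awalk u p u \<Longrightarrow> awalk u (concat (replicate m p)) u"
  by (induction m) (auto simp: awalk_Nil_iff)

text \<open>\<open>awalk_not_distinct_decomp\<close> gives a closed subwalk \<open>c\<close>. If it
  is not yet a cycle, removing its first arc leaves a shorter walk that still repeats a node, and
  the induction hypothesis finds the cycle there.\<close>

lemma awalk_nondistinct_cycle:
  assumes "awalk u p v" "\<not> distinct (awalk_verts u p)"
  shows "\<exists>q c r w. p = q @ c @ r \<and> awalk u q w \<and> awalk w c w \<and> awalk w r v \<and> cycle c"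
  using assms
proof (induction p arbitrary: u v rule: length_induct)
  case (1 p)
  obtain q c r w where dec: "p = q @ c @ r" "awalk u q w" "awalk w c w" "awalk w r v" "c \<noteq> []"
    using awalk_not_distinct_decomp[OF "1.prems"] by blast
  show ?case
  proof (cases "distinct (tl (awalk_verts w c))")
    case True
    with dec show ?thesis unfolding cycle_def by blast
  next
    case False
    obtain e es where c: "c = e # es" using dec(5) by (cases c) auto
    have es: "awalk (head G e) es w" "awalk w [e] (head G e)"
      using dec(3) by (auto simp: c awalk_simps)
    have "length es < length p" by (simp add: dec(1) c)
    moreover have "\<not> distinct (awalk_verts (head G e) es)" using False by (simp add: c)
    ultimately obtain q' c' r' w' where *: "es = q' @ c' @ r'" "awalk (head G e) q' w'"
      "awalk w' c' w'" "awalk w' r' w" "cycle c'"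
      using "1.IH" es(1) by metis
    have "p = (q @ [e] @ q') @ c' @ (r' @ r)" by (simp add: dec(1) c *(1))
    moreover have "awalk u (q @ [e] @ q') w'" "awalk w' (r' @ r) v"
      using awalk_appendI[OF dec(2) awalk_appendI[OF es(2) *(2)]]
        awalk_appendI[OF *(4) dec(4)] by simp_all
    ultimately show ?thesis using * by blast
  qed
qed

text \<open>Cut the closed walk in front of an arc leaving \<open>v\<close> and swap the two halves.
  Equality of the multisets of arcs is what later transfers the weight and the arc set.\<close>

lemma cycle_rotate:
  assumes "cycle c" "v \<in> tail G ` set c"
  obtains c' where "awalk v c' v" "mset c' = mset c"
proof -
  obtain e where "e \<in> set c" "tail G e = v" using assms(2) by auto
  then obtain p q where c: "c = p @ e # q" by (meson split_list)
  obtain u where "awalk u c u" using assms(1) unfolding cycle_def by blast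
  then have "awalk u p v" "awalk v (e # q) u"
    using \<open>tail G e = v\<close> by (auto simp: c awalk_simps)
  then have "awalk v ((e # q) @ p) v" by (rule awalk_appendI[rotated])
  then show thesis by (rule that) (simp add: c)
qed

text \<open>Both sets are read off the node sequence of the cycle, which is the list of tails
  followed by \<open>u\<close> and also \<open>u\<close> followed by the list of heads.\<close>

lemma cycle_heads: "cycle c \<Longrightarrow> head G ` set c = tail G ` set c"
proof -
  assume "cycle c"
  then obtain u where c: "awalk u c u" "c \<noteq> []" unfolding cycle_def by blast
  then have cas: "cas u c u" by blast
  have ht: "tail G (hd c) = u" using c by (cases c) (auto simp: awalk_simps)
  have hl: "head G (last c) = u" using c awlast_if_cas[OF cas] by (simp add: awalk_verts_conv)
  have "map (tail G) c @ [u] = u # map (head G) c"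
    using awalk_verts_conv'[OF cas] awalk_verts_conv[of u c] c ht hl by simp
  then have "insert u (tail G ` set c) = insert u (head G ` set c)"
    by (metis list.set_map list.simps(15) set_append Un_insert_right Un_empty_right empty_set)
  moreover have "u \<in> tail G ` set c" "u \<in> head G ` set c"
    using c ht hl by (metis hd_in_set imageI, metis last_in_set imageI)
  ultimately show ?thesis by (simp add: insert_absorb)
qed

end

lemma (in fin_digraph) length_cycle_le:
  assumes "cycle c" shows "length c \<le> card (verts G)"
proof -
  obtain u where u: "awalk u c u" "distinct (tl (awalk_verts u c))"
    using assms unfolding cycle_def by blast
  have "length c = card (set (tl (awalk_verts u c)))"
    using u(2) by (simp add: distinct_card length_awalk_verts)
  also have "\<dots> \<le> card (verts G)"
    using u(1) by (intro card_mono) (auto dest: list.set_sel(2)[OF awalk_verts_non_Nil])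
  finally show ?thesis .
qed

lemma (in fin_digraph) finite_cycles: "finite {c. cycle c}"
proof (rule finite_subset)
  show "{c. cycle c} \<subseteq> {c. set c \<subseteq> arcs G \<and> length c \<le> card (verts G)}"
    using length_cycle_le by (auto simp: cycle_def)
  show "finite \<dots>" by (intro finite_lists_length_le finite_arcs)
qed

section \<open>Positivity of the cyclicity\<close>

lemma (in fin_digraph) finite_sccs: "finite sccs"
proof -
  have "sccs_verts \<subseteq> Pow (verts G)" by (auto simp: sccs_verts_conv)
  then have "finite sccs_verts" by (rule finite_subset) simp
  then show ?thesis by (simp add: sccs_conv_sccs_verts)
qed

text \<open>Rotating the cycle to start at any of its nodes shows that its nodes reach each other,
  so they all lie in the component of \<open>v\<close>. The component is an induced subgraph and
  hence contains the arcs as well.\<close>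

lemma (in wf_digraph) scc_contains_cycle:
  assumes S: "S \<in> sccs" and c: "cycle c" "v \<in> tail G ` set c" "v \<in> verts S"
  shows "pre_digraph.cycle S c"
proof -
  have ind: "induced_subgraph S G" by (rule in_sccs_imp_induced[OF S])
  have reach: "x \<rightarrow>\<^sup>* y" if x: "x \<in> tail G ` set c" and y: "y \<in> tail G ` set c" for x y
  proof -
    obtain c' where c': "awalk x c' x" "mset c' = mset c" using cycle_rotate[OF c(1) x] .
    have "y \<in> set (awalk_verts x c')"
      using y mset_eq_setD[OF c'(2)] set_awalk_verts[OF c'(1)] by auto
    then show ?thesis using awalk_verts_reachable_from[OF c'(1)] by blast
  qed
  have SV: "verts S \<in> sccs_verts" using S by (simp add: sccs_verts_conv)
  have sub: "tail G ` set c \<subseteq> verts S"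
  proof
    fix x assume x: "x \<in> tail G ` set c"
    show "x \<in> verts S"
      using SV reach[OF x c(2)] reach[OF c(2) x] c(3) unfolding sccs_verts_def by blast
  qed
  \<comment> \<open>\<open>cas\<close> and \<open>awalk_verts\<close> depend on the digraph only
    through \<open>tail\<close> and \<open>head\<close>, so walks look the same in \<open>S\<close>
    and \<open>G\<close>.\<close>
  have eq: "tail S = tail G" "head S = head G"
    using ind by (auto simp: induced_subgraph_def subgraph_def compatible_def)
  have cas_eq: "pre_digraph.cas S x p y = cas x p y" for x p y
    by (induction p arbitrary: x) (simp_all add: pre_digraph.cas.simps eq)
  have verts_eq: "pre_digraph.awalk_verts S x p = awalk_verts x p" for x p
    by (simp add: pre_digraph.awalk_verts_conv eq)
  obtain u where u: "awalk u c u" "distinct (tl (awalk_verts u c))" "c \<noteq> []"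
    using c(1) unfolding cycle_def by blast
  have "set c \<subseteq> arcs S"
  proof
    fix e assume e: "e \<in> set c"
    then have "tail G e \<in> verts S" "head G e \<in> verts S"
      using sub cycle_heads[OF c(1)] by auto
    moreover have "e \<in> arcs G" using u(1) e by auto
    ultimately show "e \<in> arcs S" using ind by (auto simp: induced_subgraph_def)
  qed
  moreover have "u \<in> verts S"
    using sub u by (cases c) (auto simp: awalk_simps)
  ultimately have "pre_digraph.awalk S u c u"
    using u(1) by (auto simp: pre_digraph.awalk_def cas_eq)
  then show ?thesis using u by (auto simp: pre_digraph.cycle_def verts_eq)
qed

text \<open>A \<open>Gcd\<close> over the empty set is 0, as is an \<open>Lcm\<close> over an
  infinite set or one containing 0. These defaults are ruled out by a cycle in every component and
  by the finite number of components.\<close>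

lemma cyclicity_pos:
  assumes "fin_digraph G"
    and cov: "\<And>v. v \<in> verts G \<Longrightarrow> \<exists>c. pre_digraph.cycle G c \<and> v \<in> tail G ` set c"
  shows "0 < cyclicity G"
proof -
  interpret fin_digraph G by fact
  have "component_cyclicity S \<noteq> 0" if S: "S \<in> sccs" for S
  proof -
    obtain v where v: "v \<in> verts S" "v \<in> verts G"
      using S by (auto simp: sccs_def strongly_connected_def induced_subgraph_def subgraph_def)
    then obtain c where c: "pre_digraph.cycle S c"
      using cov scc_contains_cycle[OF S] by blast
    then have "length c \<noteq> 0" by (auto simp: pre_digraph.cycle_def)
    with c show ?thesis unfolding component_cyclicity_def Gcd_0_iff by blast
  qed
  then have "0 \<notin> component_cyclicity ` sccs" by (metis imageE)
  then show ?thesis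
    unfolding cyclicity_def using finite_sccs by (metis Lcm_0_iff finite_imageI gr0I)
qed

section \<open>Entries of max-algebraic powers as optimal weights of walks\<close>

locale max_matrix =
  fixes A :: "real mat" and n :: nat
  assumes carrier [simp]: "A \<in> carrier_mat n n" and nonneg: "nonneg_mat A"
begin

lemma dims [simp]: "dim_row A = n" "dim_col A = n"
  using carrier_matD[OF carrier] by blast+

sublocale fin_digraph "mat_digraph A"
proof
  have "arcs (mat_digraph A) \<subseteq> {..<n} \<times> {..<n}" by (auto simp: mat_digraph_def)
  then show "finite (arcs (mat_digraph A))" by (rule finite_subset) simp
qed (auto simp: mat_digraph_def)

lemma digraph_simps [simp]:
  "verts (mat_digraph A) = {..<n}" "tail (mat_digraph A) = fst" "head (mat_digraph A) = snd"
  by (simp_all add: mat_digraph_def)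

lemma arcs_iff: "(i, j) \<in> arcs (mat_digraph A) \<longleftrightarrow> i < n \<and> j < n \<and> A $$ (i, j) \<noteq> 0"
  by (simp add: mat_digraph_def)

lemma arc_pos: "e \<in> arcs (mat_digraph A) \<Longrightarrow> 0 < A $$ e"
  using nonneg by (cases e) (auto simp: arcs_iff nonneg_mat_def less_le)

lemma walk_weight_pos: "set p \<subseteq> arcs (mat_digraph A) \<Longrightarrow> 0 < walk_weight A p"
  by (induction p) (auto simp: arc_pos)

lemma walk_weight_nonneg: "awalk u p v \<Longrightarrow> 0 \<le> walk_weight A p"
  by (rule less_imp_le[OF walk_weight_pos]) (simp add: awalk_def)

lemma max_pow_dims [simp]: "dim_row (max_pow A k) = n" "dim_col (max_pow A k) = n"
  by (induction k) (simp_all add: max_mult_def)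

lemma max_pow_Suc_entry:
  "i < n \<Longrightarrow> j < n \<Longrightarrow>
    max_pow A (Suc k) $$ (i, j) = max_sum (\<lambda>h. max_pow A k $$ (i, h) * A $$ (h, j)) {..<n}"
  by (simp add: max_mult_def)

lemma max_pow_nonneg: "i < n \<Longrightarrow> j < n \<Longrightarrow> 0 \<le> max_pow A k $$ (i, j)"
  by (cases k) (simp_all add: max_pow_Suc_entry max_sum_nonneg del: max_pow.simps(2))

lemma walk_weight_le_max_pow:
  "awalk i p j \<Longrightarrow> walk_weight A p \<le> max_pow A (length p) $$ (i, j)"
proof (induction p arbitrary: j rule: rev_induct)
  case Nil
  then show ?case by (auto simp: awalk_Nil_iff)
next
  case (snoc e p)
  obtain h where e: "e = (h, j)" and p: "awalk i p h" and a: "e \<in> arcs (mat_digraph A)"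
    using snoc.prems by (cases e) (auto simp: awalk_simps)
  have ij: "i < n" "j < n" "h < n"
    using awalk_hd_in_verts[OF p] a by (auto simp: e arcs_iff)
  have "walk_weight A (p @ [e]) \<le> max_pow A (length p) $$ (i, h) * A $$ (h, j)"
    using mult_right_mono[OF snoc.IH[OF p]] arc_pos[OF a] by (simp add: e less_imp_le)
  also have "\<dots> \<le> max_pow A (Suc (length p)) $$ (i, j)"
    using ij by (subst max_pow_Suc_entry)
      (auto intro!: max_sum_upper[of _ _ "\<lambda>h. max_pow A (length p) $$ (i, h) * A $$ (h, j)"])
  finally show ?case by simp
qed

text \<open>With \<open>walk_weight_le_max_pow\<close>, this makes a positive entry the greatest
  weight of a walk of length \<open>k\<close>. Arcs have positive weight, so a zero entry means that
  there is no such walk.\<close>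

lemma max_pow_attained:
  assumes "i < n" "j < n" "0 < max_pow A k $$ (i, j)"
  obtains p where "awalk i p j" "length p = k" "walk_weight A p = max_pow A k $$ (i, j)"
proof -
  have "\<exists>p. awalk i p j \<and> length p = k \<and> walk_weight A p = max_pow A k $$ (i, j)"
    using assms(2,3)
  proof (induction k arbitrary: j)
    case 0
    then show ?case using assms(1)
      by (intro exI[of _ "[]"]) (auto simp: awalk_Nil_iff split: if_splits)
  next
    case (Suc k)
    obtain h where h: "h < n"
      "max_pow A k $$ (i, h) * A $$ (h, j) = max_pow A (Suc k) $$ (i, j)"
      using Suc.prems(2) unfolding max_pow_Suc_entry[OF assms(1) Suc.prems(1)]
      by (auto elim: max_sum_pos_attained[OF finite_lessThan])
    then have "max_pow A k $$ (i, h) * A $$ (h, j) > 0" using Suc.prems(2) by simp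
    then have pos: "0 < max_pow A k $$ (i, h)" "A $$ (h, j) \<noteq> 0"
      using max_pow_nonneg[OF assms(1) h(1), of k] by (auto simp: less_le)
    then obtain p where p: "awalk i p h" "length p = k" "walk_weight A p = max_pow A k $$ (i, h)"
      using Suc.IH h(1) by blast
    have "awalk i (p @ [(h, j)]) j"
      using p(1) h(1) Suc.prems(1) pos(2)
      by (auto intro!: awalk_appendI simp: awalk_simps arcs_iff)
    then show ?case using p h(2) by (intro exI[of _ "p @ [(h, j)]"]) simp
  qed
  then show thesis using that by blast
qed

lemma max_pow_add_ge:
  assumes "i < n" "h < n" "j < n"
  shows "max_pow A r $$ (i, h) * max_pow A s $$ (h, j) \<le> max_pow A (r + s) $$ (i, j)"
proof (cases "0 < max_pow A r $$ (i, h) \<and> 0 < max_pow A s $$ (h, j)")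
  case True
  obtain p where p: "awalk i p h" "length p = r" "walk_weight A p = max_pow A r $$ (i, h)"
    using max_pow_attained[OF assms(1,2) conjunct1[OF True]] .
  obtain q where q: "awalk h q j" "length q = s" "walk_weight A q = max_pow A s $$ (h, j)"
    using max_pow_attained[OF assms(2,3) conjunct2[OF True]] .
  have "awalk i (p @ q) j" by (rule awalk_appendI[OF p(1) q(1)])
  from walk_weight_le_max_pow[OF this] show ?thesis by (simp add: p(2,3) q(2,3))
next
  case False
  then have "max_pow A r $$ (i, h) * max_pow A s $$ (h, j) = 0"
    using max_pow_nonneg[of i h r] max_pow_nonneg[of h j s] assms by (auto simp: not_less)
  also have "\<dots> \<le> max_pow A (r + s) $$ (i, j)" using assms by (intro max_pow_nonneg)
  finally show ?thesis .
qed

section \<open>Critical nodes and the critical graph\<close>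

lemma critical_nodes_eq:
  "critical_nodes A = (\<Union>c\<in>{c. critical_cycle A c}. fst ` set c)"
  by (simp add: critical_nodes_def)

lemma critical_cycle_cycle: "critical_cycle A c \<Longrightarrow> cycle c"
  by (simp add: critical_cycle_def)

lemma critical_cycle_arcs: "critical_cycle A c \<Longrightarrow> set c \<subseteq> arcs (mat_digraph A)"
proof -
  assume "critical_cycle A c"
  then obtain u where "awalk u c u" using critical_cycle_cycle unfolding cycle_def by blast
  then show ?thesis by (simp add: awalk_def)
qed

lemma critical_nodes_less: "i \<in> critical_nodes A \<Longrightarrow> i < n"
  using critical_cycle_arcs by (fastforce simp: critical_nodes_eq arcs_iff)

lemma finite_critical_nodes: "finite (critical_nodes A)"
  by (rule finite_subset[of _ "{..<n}"]) (auto simp: critical_nodes_less)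

text \<open>Each critical node lies on a critical cycle, and this cycle is also a cycle of the
  critical graph.\<close>

lemma cyclicity_critical_graph_pos: "0 < cyclicity (critical_graph A)"
proof (rule cyclicity_pos)
  let ?C = "critical_graph A"
  have heads: "snd ` set c = fst ` set c" if "critical_cycle A c" for c
    using cycle_heads[OF critical_cycle_cycle[OF that]] by simp
  have "arcs ?C \<subseteq> arcs (mat_digraph A)"
    using critical_cycle_arcs by (auto simp: critical_graph_def)
  then have "finite (arcs ?C)" by (rule finite_subset) simp
  \<comment> \<open>The nodes of the critical graph are collected as tails only; a head is covered
    because it is the tail of another arc of its cycle.\<close>
  moreover have "head ?C e \<in> verts ?C" if "e \<in> arcs ?C" for e
  proof -
    obtain c where "critical_cycle A c" "e \<in> set c"
      using \<open>e \<in> arcs ?C\<close> by (auto simp: critical_graph_def)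
    then have "snd e \<in> fst ` set c" using heads by blast
    then show ?thesis
      using \<open>critical_cycle A c\<close> by (auto simp: critical_graph_def critical_nodes_eq)
  qed
  moreover have "tail ?C e \<in> verts ?C" if "e \<in> arcs ?C" for e
    using that by (auto simp: critical_graph_def critical_nodes_eq)
  moreover have "finite (verts ?C)"
    using finite_critical_nodes by (simp add: critical_graph_def)
  ultimately show "fin_digraph ?C" by unfold_locales
  fix v assume "v \<in> verts ?C"
  then obtain c where c: "critical_cycle A c" "v \<in> fst ` set c"
    by (auto simp: critical_graph_def critical_nodes_eq)
  have sel: "tail ?C = fst" "head ?C = snd" by (simp_all add: critical_graph_def)
  have cas_eq: "pre_digraph.cas ?C x p y = cas x p y" for x p y
    by (induction p arbitrary: x) (simp_all add: pre_digraph.cas.simps sel)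
  have verts_eq: "pre_digraph.awalk_verts ?C x p = awalk_verts x p" for x p
    by (simp add: pre_digraph.awalk_verts_conv sel)
  obtain u where u: "awalk u c u" "distinct (tl (awalk_verts u c))" "c \<noteq> []"
    using critical_cycle_cycle[OF c(1)] unfolding cycle_def by blast
  have "u \<in> fst ` set c" using u by (cases c) (auto simp: awalk_simps)
  then have "u \<in> verts ?C" "set c \<subseteq> arcs ?C"
    using c(1) unfolding critical_graph_def critical_nodes_eq by auto
  then have "pre_digraph.awalk ?C u c u"
    using u(1) by (simp add: pre_digraph.awalk_def cas_eq)
  then have "pre_digraph.cycle ?C c" using u by (auto simp: pre_digraph.cycle_def verts_eq)
  then show "\<exists>c. pre_digraph.cycle ?C c \<and> v \<in> tail ?C ` set c" using c(2) sel by auto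
qed

end

section \<open>Definite matrices: weights of cycles and decay of noncritical walks\<close>

locale definite_matrix = max_matrix +
  assumes definite: "definite A"
begin

lemma cycle_weight_le_1:
  assumes "cycle c" shows "walk_weight A c \<le> 1"
proof -
  have "finite {geom_mean A p |p. cycle p}" using finite_cycles by simp
  then have "geom_mean A c \<le> max_cycle_mean A"
    unfolding max_cycle_mean_def using assms by (intro Max_ge) auto
  moreover have "0 < length c" using assms by (auto simp: cycle_def)
  ultimately show ?thesis
    using definite by (simp add: definite_def geom_mean_def)
qed

text \<open>The maximum geometric mean is 1, and a root of positive degree is 1 exactly at
  1.\<close>

lemma critical_cycle_iff: "critical_cycle A c \<longleftrightarrow> cycle c \<and> walk_weight A c = 1"
proof (cases "cycle c")
  case True
  then have "0 < length c" by (auto simp: cycle_def)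
  with True show ?thesis
    using definite by (simp add: critical_cycle_def definite_def geom_mean_def)
qed (simp add: critical_cycle_def)

text \<open>There are finitely many cycles, so the maximum of their weights stays below 1; without
  noncritical cycles the default 0 of \<open>max_sum\<close> serves as \<rho>.\<close>

lemma noncritical_cycle_bound:
  obtains \<rho> where "0 \<le> \<rho>" "\<rho> < 1"
    "\<And>c. cycle c \<Longrightarrow> \<not> critical_cycle A c \<Longrightarrow> walk_weight A c \<le> \<rho>"
proof -
  let ?S = "{c. cycle c \<and> \<not> critical_cycle A c}"
  have fin: "finite ?S" by (rule finite_subset[OF _ finite_cycles]) auto
  have lt: "walk_weight A c < 1" if "c \<in> ?S" for c
    using that cycle_weight_le_1[of c] by (auto simp: critical_cycle_iff)
  show thesis
  proof (rule that)
    show "0 \<le> max_sum (walk_weight A) ?S" using fin by (rule max_sum_nonneg)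
    show "max_sum (walk_weight A) ?S < 1"
      unfolding max_sum_def using fin lt by auto
    show "walk_weight A c \<le> max_sum (walk_weight A) ?S"
      if "cycle c" "\<not> critical_cycle A c" for c
      using fin that by (intro max_sum_upper) auto
  qed
qed

text \<open>Removing cycles one at a time costs a factor of at most \<rho> each, and each removes at
  most \<open>n\<close> arcs. This gives geometric decay in \<open>length p div n\<close>.\<close>

lemma noncritical_walks_vanish:
  assumes "0 < \<epsilon>"
  obtains N where "\<And>u p v. awalk u p v \<Longrightarrow> N \<le> length p \<Longrightarrow>
    fst ` set p \<inter> critical_nodes A = {} \<Longrightarrow> walk_weight A p < \<epsilon>"
proof -
  obtain \<rho> where \<rho>: "0 \<le> \<rho>" "\<rho> < 1"
    "\<And>c. cycle c \<Longrightarrow> \<not> critical_cycle A c \<Longrightarrow> walk_weight A c \<le> \<rho>"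
    using noncritical_cycle_bound by blast
  \<comment> \<open>\<open>C\<close> bounds the walks with fewer than \<open>n\<close> arcs, where
    the induction stops with exponent 0.\<close>
  define C where "C = max_sum (walk_weight A) {p. set p \<subseteq> arcs (mat_digraph A) \<and> length p \<le> n}"
  have fin: "finite {p. set p \<subseteq> arcs (mat_digraph A) \<and> length p \<le> n}"
    by (intro finite_lists_length_le finite_arcs)
  have C0: "0 \<le> C" unfolding C_def using fin by (rule max_sum_nonneg)
  have bound: "walk_weight A p \<le> C * \<rho> ^ (length p div n)"
    if "awalk u p v" "fst ` set p \<inter> critical_nodes A = {}" for u p v
    using that
  proof (induction p arbitrary: u v rule: length_induct)
    case (1 p)
    have n: "u < n" using awalk_hd_in_verts[OF "1.prems"(1)] by simp
    show ?case
    proof (cases "length p < n")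
      case True
      have "walk_weight A p \<le> C" unfolding C_def using fin True "1.prems"(1)
        by (intro max_sum_upper) auto
      then show ?thesis using True by simp
    next
      case False
      \<comment> \<open>At least \<open>n\<close> arcs visit at least \<open>n + 1\<close> nodes,
        counted with repetition.\<close>
      have "\<not> distinct (awalk_verts u p)"
      proof
        assume "distinct (awalk_verts u p)"
        then have "Suc (length p) = card (set (awalk_verts u p))"
          by (simp add: distinct_card length_awalk_verts)
        also have "\<dots> \<le> card (verts (mat_digraph A))"
          using "1.prems"(1) by (intro card_mono finite_verts) blast
        finally show False using False by simp
      qed
      then obtain q c r w where d: "p = q @ c @ r" "awalk u q w" "awalk w c w" "awalk w r v" "cycle c"
        using awalk_nondistinct_cycle[OF "1.prems"(1)] by metis
      have c0: "c \<noteq> []" using d(5) by (auto simp: cycle_def)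
      have nc: "\<not> critical_cycle A c"
      proof
        assume "critical_cycle A c"
        then have "fst (hd c) \<in> critical_nodes A \<inter> fst ` set p"
          using c0 by (auto simp: critical_nodes_eq d(1))
        then show False using "1.prems"(2) by blast
      qed
      have "awalk u (q @ r) v" using d by (blast intro: awalk_appendI)
      moreover have "length (q @ r) < length p" using c0 by (simp add: d(1))
      moreover have "fst ` set (q @ r) \<inter> critical_nodes A = {}"
        using "1.prems"(2) by (auto simp: d(1))
      ultimately have IH: "walk_weight A (q @ r) \<le> C * \<rho> ^ (length (q @ r) div n)"
        using "1.IH" by blast
      have "length p \<le> length (q @ r) + n" using length_cycle_le[OF d(5)] by (simp add: d(1))
      then have "length p div n \<le> (length (q @ r) + n) div n" by (rule div_le_mono)
      then have len: "length p div n \<le> Suc (length (q @ r) div n)" using n by simp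
      have "walk_weight A p = walk_weight A (q @ r) * walk_weight A c" by (simp add: d(1))
      also have "\<dots> \<le> (C * \<rho> ^ (length (q @ r) div n)) * \<rho>"
        using IH \<rho>(3)[OF d(5) nc] C0 \<rho>(1) walk_weight_nonneg[OF d(3)]
        by (intro mult_mono) simp_all
      also have "\<dots> = C * \<rho> ^ Suc (length (q @ r) div n)" by simp
      also have "\<dots> \<le> C * \<rho> ^ (length p div n)"
        using len \<rho> C0 by (intro mult_left_mono power_decreasing) auto
      finally show ?thesis .
    qed
  qed
  \<comment> \<open>\<open>C + 1\<close> is a positive divisor even though only
    \<open>0 <= C\<close> has been shown.\<close>
  obtain m where m: "\<rho> ^ m < \<epsilon> / (C + 1)"
    using real_arch_pow_inv[of "\<epsilon> / (C + 1)" \<rho>] assms \<rho> C0 by auto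
  show thesis
  proof (rule that[of "m * n"])
    fix u p v
    assume p: "awalk u p v" "m * n \<le> length p" "fst ` set p \<inter> critical_nodes A = {}"
    have "0 < n" using awalk_hd_in_verts[OF p(1)] by simp
    then have "m \<le> length p div n" using p(2) by (simp add: less_eq_div_iff_mult_less_eq)
    then have "walk_weight A p \<le> C * \<rho> ^ m"
      using bound[OF p(1,3)] mult_left_mono[OF power_decreasing[of m "length p div n" \<rho>] C0] \<rho>
      by linarith
    also have "\<dots> \<le> (C + 1) * \<rho> ^ m" using \<rho>(1) by (intro mult_right_mono) auto
    also have "\<dots> < \<epsilon>" using m C0 by (simp add: pos_less_divide_eq mult.commute)
    finally show "walk_weight A p < \<epsilon>" .
  qed
qed

section \<open>Splitting a power at the critical nodes\<close>

text \<open>One inequality is concatenation of walks at a critical node. The other is the surgery on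
  walks outlined above, with congruences modulo \<gamma> written as equations between natural
  numbers.\<close>

lemma max_pow_add_via_critical:
  assumes "0 < \<gamma>" and per: "\<And>r. T \<le> r \<Longrightarrow> max_pow A (r + \<gamma>) = max_pow A r"
    and "T \<le> r" "T \<le> s" "i < n" "j < n"
  shows "max_pow A (r + s) $$ (i, j) =
    max_sum (\<lambda>h. max_pow A r $$ (i, h) * max_pow A s $$ (h, j)) (critical_nodes A)"
proof (rule antisym)
  show "max_sum (\<lambda>h. max_pow A r $$ (i, h) * max_pow A s $$ (h, j)) (critical_nodes A)
    \<le> max_pow A (r + s) $$ (i, j)"
    using assms(5,6) finite_critical_nodes
    by (auto simp: max_sum_le_iff max_pow_nonneg intro: max_pow_add_ge critical_nodes_less)
next
  let ?w = "max_pow A (r + s) $$ (i, j)"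
  have per': "max_pow A (x + \<gamma> * m) = max_pow A x" if "T \<le> x" for x m
  proof (induction m)
    case (Suc m)
    have "max_pow A (x + \<gamma> * m + \<gamma>) = max_pow A (x + \<gamma> * m)" using that by (intro per) simp
    with Suc show ?case by (simp add: algebra_simps)
  qed simp
  show "?w \<le> max_sum (\<lambda>h. max_pow A r $$ (i, h) * max_pow A s $$ (h, j)) (critical_nodes A)"
  proof (cases "0 < ?w")
    case False
    then show ?thesis using max_sum_nonneg[OF finite_critical_nodes]
      by (meson not_less order_trans)
  next
    case True
    \<comment> \<open>The threshold is the entry itself, so a walk attaining it with at least
      \<open>N\<close> arcs must leave a critical node.\<close>
    obtain N where N: "\<And>u p v. awalk u p v \<Longrightarrow> N \<le> length p \<Longrightarrow>
        fst ` set p \<inter> critical_nodes A = {} \<Longrightarrow> walk_weight A p < ?w"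
      using noncritical_walks_vanish[OF True] by blast
    have eqN: "max_pow A (r + s + \<gamma> * N) $$ (i, j) = ?w" using per' assms(3) by simp
    obtain p where p: "awalk i p j" "length p = r + s + \<gamma> * N" "walk_weight A p = ?w"
      using max_pow_attained[of i j "r + s + \<gamma> * N"] assms(5,6) True eqN by metis
    have "N \<le> length p" using assms(1) by (simp add: p(2) trans_le_add2)
    then obtain e where e: "e \<in> set p" "fst e \<in> critical_nodes A"
      using N[OF p(1)] p(3) by fastforce
    obtain p1 p2 where p12: "p = p1 @ e # p2" using split_list[OF e(1)] by blast
    let ?p2 = "e # p2" let ?v = "fst e" let ?u = "length p1"
    have w1: "awalk i p1 ?v" "awalk ?v ?p2 j" using p(1) by (auto simp: p12 awalk_simps)
    obtain c0 where c0: "critical_cycle A c0" "?v \<in> fst ` set c0"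
      using e(2) by (auto simp: critical_nodes_eq)
    obtain c where c: "awalk ?v c ?v" "mset c = mset c0"
      using cycle_rotate[OF critical_cycle_cycle[OF c0(1)], of ?v] c0(2) by auto
    have "walk_weight A c = walk_weight A c0"
      unfolding walk_weight_def prod_mset_prod_list[symmetric] mset_map c(2) ..
    then have wc: "walk_weight A c = 1" using c0(1) by (simp add: critical_cycle_iff)
    have setc: "set c = set c0" using mset_eq_setD[OF c(2)] .
    have lc: "1 \<le> length c" using c0(2) setc by (cases c) auto
    \<comment> \<open>The first part will consist of \<open>p1\<close> and \<open>a\<close> arcs of
      the laps, with total length congruent to \<open>r\<close>. The subtraction is exact since
      \<open>?u\<close> is at most \<open>\<gamma> * ?u\<close>.\<close>
    define a where "a = r + \<gamma> * ?u - ?u"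
    have a: "?u + a = r + \<gamma> * ?u"
      unfolding a_def using assms(1) by (simp add: trans_le_add2)
    \<comment> \<open>With \<open>\<gamma> * y\<close> laps the inserted length is a multiple of
      \<gamma>, and more than \<open>T\<close> arcs of it remain after the cut. So the second part
      reaches the periodic range, and the cut point \<open>h\<close> is the tail of an arc of the
      critical cycle.\<close>
    define y where "y = a + T + 1"
    define L where "L = concat (replicate (\<gamma> * y) c)"
    have L: "awalk ?v L ?v" "walk_weight A L = 1" "length L = \<gamma> * y * length c" "set L \<subseteq> set c0"
      using awalk_laps[OF c(1)] setc by (auto simp: L_def walk_weight_laps wc length_laps)
    have yL: "y \<le> length L"
      using assms(1) lc mult_le_mono[of 1 "\<gamma> * 1" 1 "length c"]
      by (simp add: L(3) Suc_leI mult.assoc)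
    obtain h where h: "awalk ?v (take a L) h" "awalk h (drop a L) ?v"
      using L(1) by (metis append_take_drop_id awalk_append_iff)
    have ne: "drop a L \<noteq> []" using yL by (simp add: y_def)
    then have "fst (hd (drop a L)) = h"
      using h(2) by (cases "drop a L") (auto simp: awalk_simps)
    moreover have "hd (drop a L) \<in> set c0"
      using hd_in_set[OF ne] L(4) in_set_dropD by fastforce
    ultimately have hc: "h \<in> critical_nodes A"
      using c0(1) by (auto simp: critical_nodes_eq)
    have x1: "awalk i (p1 @ take a L) h" "awalk h (drop a L @ ?p2) j"
      using w1 h by (blast intro: awalk_appendI)+
    have "length (p1 @ take a L) = r + \<gamma> * ?u" using yL a by (simp add: y_def)
    then have b1: "walk_weight A (p1 @ take a L) \<le> max_pow A r $$ (i, h)"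
      using walk_weight_le_max_pow[OF x1(1)] per'[OF assms(3)] by simp
    let ?s = "length (drop a L @ ?p2)"
    have "?u + length ?p2 = r + s + \<gamma> * N" using p(2) by (simp add: p12)
    moreover have "a \<le> length L" using yL by (simp add: y_def)
    ultimately have "?s + \<gamma> * ?u = s + \<gamma> * N + length L"
      using a by simp
    then have "?s + \<gamma> * ?u = s + \<gamma> * (N + y * length c)"
      by (simp add: L(3) algebra_simps)
    moreover have "T \<le> ?s" using yL by (simp add: y_def)
    \<comment> \<open>Adding \<open>?u\<close> periods to \<open>?s\<close> and
      \<open>N + y * length c\<close> periods to \<open>s\<close> leads to the same exponent, and
      both start at \<open>T\<close> or later.\<close>
    ultimately have "max_pow A ?s = max_pow A s" using per' assms(4) by metis
    then have b2: "walk_weight A (drop a L @ ?p2) \<le> max_pow A s $$ (h, j)"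
      using walk_weight_le_max_pow[OF x1(2)] by simp
    \<comment> \<open>The laps have total weight 1, so inserting and cutting them leaves the product
      of the two parts equal to the weight of \<open>p\<close>.\<close>
    have "walk_weight A (take a L) * walk_weight A (drop a L) = 1"
      using L(2) by (metis append_take_drop_id walk_weight_simps(3))
    then have "?w = walk_weight A (p1 @ take a L) * walk_weight A (drop a L @ ?p2)"
      unfolding p(3)[symmetric] p12 by simp
    also have "\<dots> \<le> max_pow A r $$ (i, h) * max_pow A s $$ (h, j)"
    proof (rule mult_mono[OF b1 b2])
      show "0 \<le> max_pow A r $$ (i, h)"
        using max_pow_nonneg assms(5) critical_nodes_less[OF hc] by simp
      show "0 \<le> walk_weight A (drop a L @ ?p2)"
        using x1(2) by (rule walk_weight_nonneg)
    qed
    also have "\<dots> \<le> max_sum (\<lambda>h. max_pow A r $$ (i, h) * max_pow A s $$ (h, j)) (critical_nodes A)"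
      using finite_critical_nodes hc
      by (rule max_sum_upper[of _ _ "\<lambda>h. max_pow A r $$ (i, h) * max_pow A s $$ (h, j)"])
    finally show ?thesis .
  qed
qed

end

section \<open>Passage from entries to rows and columns\<close>

theorem proposition4p5:
  fixes A :: "real mat" and n c \<gamma> T t l k :: nat
  assumes "A \<in> carrier_mat n n" and "nonneg_mat A"
    and "definite A" and "irreducible_mat A"
    and "critical_nodes A = {..<c}"
    and "\<gamma> = cyclicity (critical_graph A)"
    and "is_transient A T" and "T \<le> t * \<gamma>"
    and "k < n"
  shows "row (max_pow A (t * \<gamma> + l)) k =
           max_sum_vec n (\<lambda>i. max_pow A (t * \<gamma>) $$ (k, i) \<cdot>\<^sub>v row (max_pow A (t * \<gamma> + l)) i) {..<c}
       \<and> col (max_pow A (t * \<gamma> + l)) k =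
           max_sum_vec n (\<lambda>i. max_pow A (t * \<gamma>) $$ (i, k) \<cdot>\<^sub>v col (max_pow A (t * \<gamma> + l)) i) {..<c}"
proof -
  interpret definite_matrix A n using assms(1-3) by unfold_locales
  have \<gamma>: "0 < \<gamma>" using cyclicity_critical_graph_pos by (simp add: assms(6))
  have per: "max_pow A (r + \<gamma>) = max_pow A r" if "T \<le> r" for r
    using assms(7) that by (simp add: is_transient_def Let_def assms(6))
  let ?r = "t * \<gamma>" let ?s = "t * \<gamma> + l"
  \<comment> \<open>As \<open>?r\<close> consists of \<open>t\<close> full periods, the power with
    exponent \<open>?s + ?r\<close> is the one with exponent \<open>?s\<close>, and the splitting
    lemma can be applied to it.\<close>
  have "max_pow A (?s + m * \<gamma>) = max_pow A ?s" for m
  proof (induction m)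
    case (Suc m)
    have "max_pow A (?s + m * \<gamma> + \<gamma>) = max_pow A (?s + m * \<gamma>)" using assms(8) by (intro per) simp
    with Suc show ?case by (simp add: algebra_simps)
  qed simp
  then have eq: "max_pow A (?s + ?r) = max_pow A ?s" .
  have lt: "i < n" if "i < c" for i using critical_nodes_less assms(5) that by blast
  \<comment> \<open>The exponent is split with \<open>?r\<close> first for rows and
    \<open>?s\<close> first for columns, so that the factor with exponent \<open>?r\<close> carries
    the fixed index \<open>k\<close>.\<close>
  have rows: "max_pow A ?s $$ (k, j) =
      max_sum (\<lambda>i. max_pow A ?r $$ (k, i) * max_pow A ?s $$ (i, j)) {..<c}" if "j < n" for j
    using max_pow_add_via_critical[OF \<gamma> per, of T ?r ?s k j] eq assms(5,8,9) that
    by (simp add: add.commute)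
  have cols: "max_pow A ?s $$ (j, k) =
      max_sum (\<lambda>i. max_pow A ?r $$ (i, k) * max_pow A ?s $$ (j, i)) {..<c}" if "j < n" for j
    using max_pow_add_via_critical[OF \<gamma> per, of T ?s ?r j k] eq assms(5,8,9) that
    by (simp add: mult.commute)
  \<comment> \<open>The summands can be evaluated only at indices below \<open>n\<close>, so the
    congruence rule supplies \<open>i < c\<close>, from which \<open>lt\<close> gives
    \<open>i < n\<close>.\<close>
  have cong: "max_sum f {..<c} = max_sum g {..<c}" if "\<And>i. i < c \<Longrightarrow> f i = g i" for f g
    using that
    by (auto simp: max_sum_def intro!: arg_cong[of _ _ "\<lambda>X. Max (insert 0 X)"] image_cong)
  show ?thesis
    using assms(9) lt
    by (auto intro!: eq_vecI cong simp: max_sum_vec_def rows cols)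
qed

end
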